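(* Let $(r,s,i,j)\in\mu^{-1}(0)^{rss}$ and let $b\in B$ be an element with $b=\sum_{\iota=1}^n E_{\iota\iota}\,\mathrm{diag}(b)\,L^{\iota}$ (such a $b$ diagonalizes $r$), so that $$(brb^{-1},\ \overline{bsb^{-1}},\ bi,\ jb^{-1})=(\mathrm{diag}(r),s',i',j').$$ Then each diagonal coordinate of $s'=(s'_{\iota\gamma})$ is $$s'_{\iota\iota}=\left[\mathrm{tr}\Big(\prod_{1\le k\le n,\,k\ne\iota} l_k(r)\Big)\right]^{-1}\mathrm{tr}\Big(\prod_{1\le k\le n,\,k\ne\iota} l_k(r)\; s\Big),\qquad 1\le\iota\le n.$$
   Context: Let $n\ge 1$, $G=GL_n(\mathbb{C})$, $\mathfrak{g}=\mathfrak{gl}_n(\mathbb{C})$, $B\subset G$ the group of invertible upper triangular matrices, $\mathfrak{b}$ its Lie algebra (upper triangular matrices), $\mathfrak{u}\subset\mathfrak{g}$ the strictly upper triangular matrices. Identify $\mathfrak{b}^*\cong\mathfrak{g}/\mathfrak{u}$ via the trace pairing $(r,s)\mapsto\mathrm{tr}(rs)$; $\overline{v}$ is the class of $v\in\mathfrak{g}$ in $\mathfrak{g}/\mathfrak{u}$. An element $s\in\mathfrak{b}^*$ has a unique lower triangular representative $s=(s_{\iota\gamma})$; its entries with $\iota\ge\gamma$ are its coordinates. Identify $T^*(\mathfrak{b}\times\mathbb{C}^n)=\mathfrak{b}\times\mathfrak{b}^*\times\mathbb{C}^n\times(\mathbb{C}^n)^*$, with points $(r,s,i,j)$, $i$ a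 column vector and $j$ a row vector. The moment map is $\mu(r,s,i,j)=\overline{[r,s]+ij}\in\mathfrak{b}^*$. Set $\mu^{-1}(0)^{rss}=\{(r,s,i,j)\in\mu^{-1}(0): r\text{ has pairwise distinct eigenvalues}\}$. $\mathrm{diag}(a)$ denotes the diagonal matrix with the same diagonal entries as $a$; $E_{\iota\iota}$ has $1$ in entry $(\iota,\iota)$ and $0$ elsewhere. For $r=(r_{\iota\gamma})$ put $l_k(r)=r-r_{kk}I_n$ and $$L^{\iota}=\Big[\mathrm{tr}\Big(\prod_{k\neq\iota}l_k(r)\Big)\Big]^{-1}\prod_{k\ne\iota}l_k(r)$$ (products over $1\le k\le n$; empty product is $I_n$). The trace of an upper triangular matrix times $s\in\mathfrak{g}/\mathfrak{u}$ is well defined. *)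

theory Defs
  imports "Jordan_Normal_Form.Spectral_Radius" "Jordan_Normal_Form.Gauss_Jordan_Elimination"
begin

text \<open>
  Rows and columns are indexed by \<open>0, \<dots>, n - 1\<close>.  Column vectors are \<open>n \<times> 1\<close> matrices and
  row vectors are \<open>1 \<times> n\<close> matrices, so that \<open>i * j\<close>, \<open>b * i\<close> and \<open>j * b\<^sup>-\<^sup>1\<close> are
  matrix products.
\<close>

definition borel_algebra :: "nat \<Rightarrow> complex mat set" where
  "borel_algebra n = {r \<in> carrier_mat n n. upper_triangular r}"

definition borel_group :: "nat \<Rightarrow> complex mat set" where
  "borel_group n = {b \<in> carrier_mat n n. upper_triangular b \<and> invertible_mat b}"

definition nilradical :: "nat \<Rightarrow> complex mat set" where
  "nilradical n = {u \<in> carrier_mat n n. \<forall>\<iota><n. \<forall>\<gamma>\<le>\<iota>. u $$ (\<iota>, \<gamma>) = 0}"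

abbreviation minv :: "complex mat \<Rightarrow> complex mat" where
  "minv b \<equiv> the (mat_inverse b)"

definition mat_trace :: "complex mat \<Rightarrow> complex" where
  "mat_trace A = (\<Sum>k<dim_row A. A $$ (k, k))"

definition diag_part :: "nat \<Rightarrow> complex mat \<Rightarrow> complex mat" where
  "diag_part n a = mat_diag n (\<lambda>k. a $$ (k, k))"

definition matrix_unit :: "nat \<Rightarrow> nat \<Rightarrow> complex mat" where
  "matrix_unit n \<iota> = mat_diag n (\<lambda>k. if k = \<iota> then 1 else 0)"

subsection \<open>The dual of the Borel subalgebra as a quotient\<close>

definition coset_u :: "nat \<Rightarrow> complex mat \<Rightarrow> complex mat set" where
  "coset_u n v = (\<lambda>u. v + u) ` nilradical n"

definition borel_dual :: "nat \<Rightarrow> complex mat set set" where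
  "borel_dual n = coset_u n ` carrier_mat n n"

text \<open>
  Operations on cosets are given by applying the matrix operation to all members; the lemmas at
  the end show that the result is independent of the member.
\<close>

definition lower_rep :: "nat \<Rightarrow> complex mat set \<Rightarrow> complex mat" where
  "lower_rep n s = (THE v. v \<in> s \<and> (\<forall>\<iota><n. \<forall>\<gamma><n. \<iota> < \<gamma> \<longrightarrow> v $$ (\<iota>, \<gamma>) = 0))"

definition trace_pairing :: "complex mat \<Rightarrow> complex mat set \<Rightarrow> complex" where
  "trace_pairing a s = the_elem ((\<lambda>v. mat_trace (a * v)) ` s)"

definition conj_dual :: "nat \<Rightarrow> complex mat \<Rightarrow> complex mat set \<Rightarrow> complex mat set" where
  "conj_dual n b s = (\<Union>v\<in>s. coset_u n (b * v * minv b))"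

subsection \<open>The cotangent bundle and the moment map\<close>

type_synonym cotangent_point = "complex mat \<times> complex mat set \<times> complex mat \<times> complex mat"

definition cotangent :: "nat \<Rightarrow> cotangent_point set" where
  "cotangent n = borel_algebra n \<times> borel_dual n \<times> carrier_mat n 1 \<times> carrier_mat 1 n"

fun moment_map :: "nat \<Rightarrow> cotangent_point \<Rightarrow> complex mat set" where
  "moment_map n (r, s, i, j) = (\<Union>v\<in>s. coset_u n ((r * v - v * r) + i * j))"

fun borel_act :: "nat \<Rightarrow> complex mat \<Rightarrow> cotangent_point \<Rightarrow> cotangent_point" where
  "borel_act n b (r, s, i, j) = (b * r * minv b, conj_dual n b s, b * i, j * minv b)"

text \<open>An \<open>n \<times> n\<close> matrix has pairwise distinct eigenvalues iff its spectrum has \<open>n\<close> elements.\<close>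

definition moment_zero_rss :: "nat \<Rightarrow> cotangent_point set" where
  "moment_zero_rss n = {(r, s, i, j). (r, s, i, j) \<in> cotangent n \<and>
     moment_map n (r, s, i, j) = coset_u n (0\<^sub>m n n) \<and> card (spectrum r) = n}"

subsection \<open>The matrices \<open>L\<close>\<close>

definition l_mat :: "nat \<Rightarrow> complex mat \<Rightarrow> nat \<Rightarrow> complex mat" where
  "l_mat n r k = r - r $$ (k, k) \<cdot>\<^sub>m 1\<^sub>m n"

text \<open>The factors commute; the product is taken in increasing order of \<open>k\<close>.\<close>

definition l_prod :: "nat \<Rightarrow> complex mat \<Rightarrow> nat \<Rightarrow> complex mat" where
  "l_prod n r \<iota> = foldr (\<lambda>k A. l_mat n r k * A) (filter (\<lambda>k. k \<noteq> \<iota>) [0..<n]) (1\<^sub>m n)"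

definition L_mat :: "nat \<Rightarrow> complex mat \<Rightarrow> nat \<Rightarrow> complex mat" where
  "L_mat n r \<iota> = inverse (mat_trace (l_prod n r \<iota>)) \<cdot>\<^sub>m l_prod n r \<iota>"

subsection \<open>Well-definedness of the operations on cosets\<close>

lemma zero_in_nilradical: "0\<^sub>m n n \<in> nilradical n"
  by (auto simp: nilradical_def)

lemma nilradical_add: "u \<in> nilradical n \<Longrightarrow> w \<in> nilradical n \<Longrightarrow> u + w \<in> nilradical n"
  by (auto simp: nilradical_def)

lemma nilradical_uminus: "u \<in> nilradical n \<Longrightarrow> - u \<in> nilradical n"
  by (auto simp: nilradical_def)

lemma nilradical_minus:
  assumes "u \<in> nilradical n" and "w \<in> nilradical n" shows "u - w \<in> nilradical n"
  using assms by (auto simp: nilradical_def)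

lemma nilradical_carrier: "u \<in> nilradical n \<Longrightarrow> u \<in> carrier_mat n n"
  by (auto simp: nilradical_def)

lemma nilradical_mult_left:
  assumes "r \<in> borel_algebra n" and "u \<in> nilradical n" shows "r * u \<in> nilradical n"
proof -
  have "(r * u) $$ (\<iota>, \<gamma>) = 0" if "\<iota> < n" "\<gamma> \<le> \<iota>" for \<iota> \<gamma>
  proof -
    have "(r * u) $$ (\<iota>, \<gamma>) = (\<Sum>k = 0..<n. r $$ (\<iota>, k) * u $$ (k, \<gamma>))"
      using assms that by (auto simp: borel_algebra_def nilradical_def scalar_prod_def)
    also have "\<dots> = 0"
    proof (rule sum.neutral, intro ballI)
      fix k assume k: "k \<in> {0..<n}"
      show "r $$ (\<iota>, k) * u $$ (k, \<gamma>) = 0"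
        using assms that k by (cases "k < \<iota>") (auto simp: borel_algebra_def nilradical_def)
    qed
    finally show ?thesis .
  qed
  then show ?thesis using assms by (auto simp: borel_algebra_def nilradical_def)
qed

lemma nilradical_mult_right:
  assumes "r \<in> borel_algebra n" and "u \<in> nilradical n" shows "u * r \<in> nilradical n"
proof -
  have "(u * r) $$ (\<iota>, \<gamma>) = 0" if "\<iota> < n" "\<gamma> \<le> \<iota>" for \<iota> \<gamma>
  proof -
    have "(u * r) $$ (\<iota>, \<gamma>) = (\<Sum>k = 0..<n. u $$ (\<iota>, k) * r $$ (k, \<gamma>))"
      using assms that by (auto simp: borel_algebra_def nilradical_def scalar_prod_def)
    also have "\<dots> = 0"
    proof (rule sum.neutral, intro ballI)
      fix k assume k: "k \<in> {0..<n}"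
      show "u $$ (\<iota>, k) * r $$ (k, \<gamma>) = 0"
        using assms that k by (cases "k \<le> \<iota>") (auto simp: borel_algebra_def nilradical_def upper_triangular_def)
    qed
    finally show ?thesis .
  qed
  then show ?thesis using assms by (auto simp: borel_algebra_def nilradical_def)
qed

lemma coset_u_eqI:
  assumes v: "v \<in> carrier_mat n n" and u: "u \<in> nilradical n"
  shows "coset_u n (v + u) = coset_u n v"
proof -
  note uc = nilradical_carrier[OF u]
  have "v + u + w \<in> coset_u n v" if "w \<in> nilradical n" for w
    unfolding coset_u_def
    using nilradical_add[OF u that] v uc nilradical_carrier[OF that]
    by (auto simp: assoc_add_mat[of _ n n] intro!: image_eqI[of _ _ "u + w"])
  moreover have "v + w \<in> coset_u n (v + u)" if "w \<in> nilradical n" for w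
  proof -
    have "v + w = v + u + (w - u)"
      using v uc nilradical_carrier[OF that] by (intro eq_matI) auto
    then show ?thesis
      unfolding coset_u_def using nilradical_minus[OF that u] by blast
  qed
  ultimately show ?thesis by (auto simp: coset_u_def)
qed

lemma coset_u_self: "v \<in> carrier_mat n n \<Longrightarrow> v \<in> coset_u n v"
  unfolding coset_u_def using zero_in_nilradical by (force intro: image_eqI[of _ _ "0\<^sub>m n n"])

lemma coset_u_lift:
  assumes v: "v \<in> carrier_mat n n"
    and f: "\<And>w. w \<in> coset_u n v \<Longrightarrow> f w \<in> carrier_mat n n \<and> (\<exists>u\<in>nilradical n. f w = f v + u)"
  shows "(\<Union>w\<in>coset_u n v. coset_u n (f w)) = coset_u n (f v)"
proof -
  have "coset_u n (f w) = coset_u n (f v)" if "w \<in> coset_u n v" for w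
    using f[OF that] f[OF coset_u_self[OF v]] coset_u_eqI by metis
  then show ?thesis using coset_u_self[OF v] by blast
qed

lemma moment_map_coset:
  assumes r: "r \<in> borel_algebra n" and v: "v \<in> carrier_mat n n"
    and i: "i \<in> carrier_mat n 1" and j: "j \<in> carrier_mat 1 n"
  shows "moment_map n (r, coset_u n v, i, j) = coset_u n ((r * v - v * r) + i * j)"
  unfolding moment_map.simps
proof (rule coset_u_lift[OF v])
  fix w assume "w \<in> coset_u n v"
  then obtain u where u: "u \<in> nilradical n" and w: "w = v + u" by (auto simp: coset_u_def)
  have rc: "r \<in> carrier_mat n n" using r by (simp add: borel_algebra_def)
  note uc = nilradical_carrier[OF u]
  have "r * u - u * r \<in> nilradical n"
    using nilradical_minus nilradical_mult_left[OF r u] nilradical_mult_right[OF r u] by blast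
  moreover have "r * w - w * r + i * j = (r * v - v * r + i * j) + (r * u - u * r)"
  proof -
    have "r * w = r * v + r * u" "w * r = v * r + u * r"
      unfolding w using rc v uc by (auto simp: mult_add_distrib_mat add_mult_distrib_mat)
    then show ?thesis using rc v uc i j by (intro eq_matI) (auto simp del: index_mult_mat(1))
  qed
  ultimately show "r * w - w * r + i * j \<in> carrier_mat n n \<and>
      (\<exists>u\<in>nilradical n. r * w - w * r + i * j = r * v - v * r + i * j + u)"
    using rc i j uc v w by auto
qed

lemma minv:
  assumes b: "b \<in> borel_group n"
  shows "b * minv b = 1\<^sub>m n" "minv b * b = 1\<^sub>m n" "minv b \<in> borel_algebra n"
proof -
  have bc: "b \<in> carrier_mat n n" and ut: "upper_triangular b" and "invertible_mat b"
    using b by (auto simp: borel_group_def)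
  then obtain c where c: "b * c = 1\<^sub>m n" "c * b = 1\<^sub>m (dim_row c)"
    by (auto simp: invertible_mat_def inverts_mat_def)
  have "dim_row c = n" "dim_col c = n"
    using arg_cong[OF c(1), of dim_col] arg_cong[OF c(2), of dim_col] bc by auto
  then have cc: "c \<in> carrier_mat n n" and cb: "c * b = 1\<^sub>m n" using c by auto
  have "b \<in> Units (ring_mat TYPE(complex) n ())"
    using bc cc c cb by (auto simp: Units_def ring_mat_def)
  then obtain d where d: "mat_inverse b = Some d"
    using mat_inverse(1)[OF bc, where b = "()"] by (cases "mat_inverse b") auto
  have bd: "b * d = 1\<^sub>m n" and db: "d * b = 1\<^sub>m n" and dc: "d \<in> carrier_mat n n"
    using mat_inverse(2)[OF bc d] by auto
  have "det b * det d = 1" using det_mult[OF bc dc] bd by simp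
  then have "det b \<noteq> 0" by auto
  then have "(\<Prod>k = 0..<n. b $$ (k, k)) \<noteq> 0"
    using det_upper_triangular[OF ut bc] bc by (simp add: prod_list_diag_prod)
  then have nz: "b $$ (k, k) \<noteq> 0" if "k < n" for k using that by auto
  have "\<gamma> < \<iota> \<Longrightarrow> \<iota> < n \<Longrightarrow> d $$ (\<iota>, \<gamma>) = 0" for \<iota> \<gamma>
  proof (induction "n - \<iota>" arbitrary: \<iota> rule: less_induct)
    case less
    have "0 = (b * d) $$ (\<iota>, \<gamma>)" using less.prems bd by simp
    also have "\<dots> = (\<Sum>k\<in>{0..<n}. b $$ (\<iota>, k) * d $$ (k, \<gamma>))"
      using less.prems bc dc by (auto simp: scalar_prod_def)
    also have "\<dots> = (\<Sum>k\<in>{0..<n}. if k = \<iota> then b $$ (\<iota>, \<iota>) * d $$ (\<iota>, \<gamma>) else 0)"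
    proof (rule sum.cong[OF refl])
      fix k assume "k \<in> {0..<n}"
      then show "b $$ (\<iota>, k) * d $$ (k, \<gamma>) = (if k = \<iota> then b $$ (\<iota>, \<iota>) * d $$ (\<iota>, \<gamma>) else 0)"
        using less.hyps[of k] less.prems ut bc
        by (cases k \<iota> rule: linorder_cases) auto
    qed
    also have "\<dots> = b $$ (\<iota>, \<iota>) * d $$ (\<iota>, \<gamma>)" using less.prems by simp
    finally show ?case using nz less.prems by simp
  qed
  then have "upper_triangular d" using dc by (auto simp: upper_triangular_def)
  then show "b * minv b = 1\<^sub>m n" "minv b * b = 1\<^sub>m n" "minv b \<in> borel_algebra n"
    using bd db dc d by (auto simp: borel_algebra_def)
qed

lemma conj_dual_coset:
  assumes b: "b \<in> borel_group n" and v: "v \<in> carrier_mat n n"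
  shows "conj_dual n b (coset_u n v) = coset_u n (b * v * minv b)"
  unfolding conj_dual_def
proof (rule coset_u_lift[OF v])
  fix w assume "w \<in> coset_u n v"
  then obtain u where u: "u \<in> nilradical n" and w: "w = v + u" by (auto simp: coset_u_def)
  have bb: "b \<in> borel_algebra n" and bc: "b \<in> carrier_mat n n"
    using b by (auto simp: borel_group_def borel_algebra_def)
  note mb = minv(3)[OF b]
  have mc: "minv b \<in> carrier_mat n n" using mb by (simp add: borel_algebra_def)
  note uc = nilradical_carrier[OF u]
  have "b * u * minv b \<in> nilradical n"
    using nilradical_mult_right[OF mb nilradical_mult_left[OF bb u]] .
  moreover have "b * w * minv b = b * v * minv b + b * u * minv b"
    unfolding w using bc mc v uc
    by (simp add: mult_add_distrib_mat[of _ n n] add_mult_distrib_mat[of _ n n])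
  ultimately show "b * w * minv b \<in> carrier_mat n n \<and>
      (\<exists>u\<in>nilradical n. b * w * minv b = b * v * minv b + u)"
    using bc mc by (auto simp: nilradical_carrier)
qed

lemma trace_pairing_coset:
  assumes a: "a \<in> borel_algebra n" and v: "v \<in> carrier_mat n n"
  shows "trace_pairing a (coset_u n v) = mat_trace (a * v)"
proof -
  have ac: "a \<in> carrier_mat n n" using a by (simp add: borel_algebra_def)
  have "mat_trace (a * (v + u)) = mat_trace (a * v)" if u: "u \<in> nilradical n" for u
  proof -
    have "a * (v + u) = a * v + a * u"
      using mult_add_distrib_mat[OF ac v nilradical_carrier[OF u]] .
    moreover have "(a * u) $$ (k, k) = 0" if "k < n" for k
      using nilradical_mult_left[OF a u] that by (simp add: nilradical_def)
    ultimately show ?thesis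
      using ac v nilradical_carrier[OF u]
      by (auto simp: mat_trace_def simp del: index_mult_mat(1) intro!: sum.cong)
  qed
  then have "(\<lambda>w. mat_trace (a * w)) ` coset_u n v = {mat_trace (a * v)}"
    using zero_in_nilradical by (force simp: coset_u_def image_image)
  then show ?thesis by (simp add: trace_pairing_def)
qed

lemma lower_rep_coset:
  assumes v: "v \<in> carrier_mat n n"
  shows "lower_rep n (coset_u n v) = mat n n (\<lambda>(\<iota>, \<gamma>). if \<gamma> \<le> \<iota> then v $$ (\<iota>, \<gamma>) else 0)"
    (is "_ = ?m")
  unfolding lower_rep_def
proof (rule the_equality)
  have "?m - v \<in> nilradical n" using v by (auto simp: nilradical_def)
  moreover have "?m = v + (?m - v)" using v by (intro eq_matI) auto
  ultimately have "?m \<in> coset_u n v" unfolding coset_u_def by blast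
  then show "?m \<in> coset_u n v \<and> (\<forall>\<iota><n. \<forall>\<gamma><n. \<iota> < \<gamma> \<longrightarrow> ?m $$ (\<iota>, \<gamma>) = 0)" by auto
next
  fix w assume w: "w \<in> coset_u n v \<and> (\<forall>\<iota><n. \<forall>\<gamma><n. \<iota> < \<gamma> \<longrightarrow> w $$ (\<iota>, \<gamma>) = 0)"
  then obtain u where u: "u \<in> nilradical n" and wu: "w = v + u" by (auto simp: coset_u_def)
  note uc = nilradical_carrier[OF u]
  show "w = ?m"
  proof (rule eq_matI)
    fix \<iota> \<gamma> assume a: "\<iota> < dim_row ?m" "\<gamma> < dim_col ?m"
    show "w $$ (\<iota>, \<gamma>) = ?m $$ (\<iota>, \<gamma>)"
    proof (cases "\<gamma> \<le> \<iota>")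
      case True
      then have "u $$ (\<iota>, \<gamma>) = 0" using u a by (simp add: nilradical_def)
      then show ?thesis using True a wu v uc by auto
    next
      case False
      then show ?thesis using w a by auto
    qed
  qed (use wu v uc in auto)
qed

end

theory Submission
  imports Defs
begin

text \<open>
  Write \<open>P\<^sub>\<iota>\<close> for the product of the \<open>r - r\<^sub>k\<^sub>k\<close> over \<open>k \<noteq> \<iota>\<close>.  Restoring the missing factor gives
  the characteristic polynomial of \<open>r\<close> evaluated at \<open>r\<close>, which vanishes, so
  \<open>P\<^sub>\<iota> r = r\<^sub>\<iota>\<^sub>\<iota> P\<^sub>\<iota>\<close> (lemma \<open>l_prod_mult_self\<close>): every nonzero row of \<open>P\<^sub>\<iota>\<close> is a left
  eigenvector of \<open>r\<close> for \<open>r\<^sub>\<iota>\<^sub>\<iota>\<close>.  The formula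
  for \<open>b\<close> says that row \<open>\<iota>\<close> of \<open>b\<close> is a multiple of row \<open>\<iota>\<close> of \<open>P\<^sub>\<iota>\<close>; therefore
  \<open>b r = diag(r) b\<close>, which is the first claim.

  Conjugation by \<open>b\<close> therefore turns products of the \<open>r - r\<^sub>k\<^sub>k\<close> into products of the
  \<open>diag(r) - r\<^sub>k\<^sub>k\<close>, which are diagonal.  The
  product belonging to \<open>P\<^sub>\<iota>\<close> vanishes on the diagonal except in place \<open>\<iota>\<close>, so
  \<open>b P\<^sub>\<iota> b\<^sup>-\<^sup>1 = q E\<^sub>\<iota>\<^sub>\<iota>\<close> for a scalar \<open>q\<close>.  By invariance of the trace under cyclic permutation,
  \<open>tr(P\<^sub>\<iota> v)\<close> is \<open>q\<close> times the \<open>\<iota>\<close>-th diagonal entry of \<open>b v b\<^sup>-\<^sup>1\<close> for every matrix \<open>v\<close>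
  (lemma \<open>trace_l_prod_mult\<close>).  With \<open>v = 1\<close> this identifies \<open>q\<close> as \<open>tr(P\<^sub>\<iota>)\<close>, and with \<open>v\<close> a
  representative of \<open>s\<close> it is the second claim multiplied by \<open>tr(P\<^sub>\<iota>)\<close>.  That trace can be divided
  out: it is nonzero because row \<open>\<iota>\<close> of the invertible matrix \<open>b\<close> is nonzero.
\<close>

section \<open>Traces and sums of matrices\<close>

lemma mat_trace_mult_commute:
  assumes A: "A \<in> carrier_mat n m" and B: "B \<in> carrier_mat m n"
  shows "mat_trace (A * B) = mat_trace (B * A)"
proof -
  have "mat_trace (A * B) = (\<Sum>k<n. \<Sum>l<m. A $$ (k, l) * B $$ (l, k))"
    using A B by (auto simp: mat_trace_def scalar_prod_def atLeast0LessThan intro!: sum.cong)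
  also have "\<dots> = (\<Sum>l<m. \<Sum>k<n. B $$ (l, k) * A $$ (k, l))"
    by (subst sum.swap) (simp add: mult.commute)
  also have "\<dots> = mat_trace (B * A)"
    using A B by (auto simp: mat_trace_def scalar_prod_def atLeast0LessThan intro!: sum.cong)
  finally show ?thesis .
qed

lemma mat_trace_diag_mult:
  assumes A: "A \<in> carrier_mat n n"
  shows "mat_trace (mat_diag n f * A) = (\<Sum>k<n. f k * A $$ (k, k))"
  using A by (simp add: mat_diag_mult_left mat_trace_def)

lemma index_finsum_mat:
  assumes "finite I" and "\<And>x. x \<in> I \<Longrightarrow> f x \<in> carrier_mat n m" and "k < n" "l < m"
  shows "finsum (module_mat TYPE('a :: comm_ring_1) n m) f I $$ (k, l) = (\<Sum>x\<in>I. f x $$ (k, l))"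
  using assms(1,2)
proof (induction I rule: finite_induct)
  case empty
  interpret abelian_group "module_mat TYPE('a) n m" by (rule abelian_group_mat)
  show ?case using assms(3,4) by (simp add: module_mat_simps)
next
  case (insert x I)
  interpret abelian_group "module_mat TYPE('a) n m" by (rule abelian_group_mat)
  have c: "f \<in> I \<rightarrow> carrier (module_mat TYPE('a) n m)" "f x \<in> carrier (module_mat TYPE('a) n m)"
    using insert.prems by (auto simp: module_mat_simps)
  have "finsum (module_mat TYPE('a) n m) f I \<in> carrier_mat n m"
    using finsum_closed[OF c(1)] by (simp add: module_mat_simps)
  then show ?case
    using finsum_insert[OF insert.hyps c] insert assms(3,4) by (simp add: module_mat_simps)
qed

section \<open>Products of shifts of a triangular matrix\<close>

text \<open>
  The product in \<open>l_prod\<close> for an arbitrary list of indices, so that it can be split at \<open>\<iota>\<close> and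
  built up one factor at a time.
\<close>

definition shift_prod :: "nat \<Rightarrow> complex mat \<Rightarrow> nat list \<Rightarrow> complex mat" where
  "shift_prod n r ks = foldr (\<lambda>k A. l_mat n r k * A) ks (1\<^sub>m n)"

lemma shift_prod_Nil [simp]: "shift_prod n r [] = 1\<^sub>m n"
  and shift_prod_Cons [simp]: "shift_prod n r (k # ks) = l_mat n r k * shift_prod n r ks"
  by (simp_all add: shift_prod_def)

lemma l_prod_eq_shift_prod: "l_prod n r \<iota> = shift_prod n r (filter (\<lambda>k. k \<noteq> \<iota>) [0..<n])"
  by (simp add: l_prod_def shift_prod_def)

lemma l_mat_carrier [simp]: "r \<in> carrier_mat n n \<Longrightarrow> l_mat n r k \<in> carrier_mat n n"
  by (auto simp: l_mat_def)

lemma shift_prod_carrier [simp]: "r \<in> carrier_mat n n \<Longrightarrow> shift_prod n r ks \<in> carrier_mat n n"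
  by (induction ks) (auto intro: mult_carrier_mat[of _ n n _ n])

lemma l_prod_carrier [simp]: "r \<in> carrier_mat n n \<Longrightarrow> l_prod n r \<iota> \<in> carrier_mat n n"
  by (simp add: l_prod_eq_shift_prod)

lemma shift_prod_append:
  assumes "r \<in> carrier_mat n n"
  shows "shift_prod n r (ks @ ls) = shift_prod n r ks * shift_prod n r ls"
  using assms left_mult_one_mat[OF shift_prod_carrier[OF assms]]
  by (induction ks) (auto simp: assoc_mult_mat[of _ n n _ n _ n])

lemma mult_l_mat_right:
  assumes "A \<in> carrier_mat n n" "r \<in> carrier_mat n n"
  shows "A * l_mat n r k = A * r - r $$ (k, k) \<cdot>\<^sub>m A"
  using assms by (simp add: l_mat_def mult_minus_distrib_mat[of _ n n] mult_smult_distrib[of _ n n _ n])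

lemma mult_l_mat_left:
  assumes "A \<in> carrier_mat n n" "r \<in> carrier_mat n n"
  shows "l_mat n r k * A = r * A - r $$ (k, k) \<cdot>\<^sub>m A"
  using assms
  by (simp add: l_mat_def minus_mult_distrib_mat[of _ n n] mult_smult_assoc_mat[of _ n n])

lemma shift_prod_commute:
  assumes r: "r \<in> carrier_mat n n"
  shows "shift_prod n r ks * l_mat n r k = l_mat n r k * shift_prod n r ks"
proof (induction ks)
  case (Cons m ks)
  have "l_mat n r m * l_mat n r k = l_mat n r m * r - r $$ (k, k) \<cdot>\<^sub>m l_mat n r m"
    by (rule mult_l_mat_right[OF l_mat_carrier[OF r] r])
  also have "\<dots> = r * l_mat n r m - r $$ (k, k) \<cdot>\<^sub>m l_mat n r m"
    unfolding mult_l_mat_right[OF r r] mult_l_mat_left[OF r r] ..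
  also have "\<dots> = l_mat n r k * l_mat n r m"
    by (rule mult_l_mat_left[OF l_mat_carrier[OF r] r, symmetric])
  finally have comm: "l_mat n r m * l_mat n r k = l_mat n r k * l_mat n r m" .
  note carr = l_mat_carrier[OF r] shift_prod_carrier[OF r]
  have "shift_prod n r (m # ks) * l_mat n r k = l_mat n r m * (shift_prod n r ks * l_mat n r k)"
    unfolding shift_prod_Cons by (rule assoc_mult_mat[OF carr(1,2,1)])
  also have "\<dots> = (l_mat n r m * l_mat n r k) * shift_prod n r ks"
    unfolding Cons.IH by (rule assoc_mult_mat[OF carr(1,1,2), symmetric])
  also have "\<dots> = l_mat n r k * shift_prod n r (m # ks)"
    unfolding comm shift_prod_Cons by (rule assoc_mult_mat[OF carr(1,1,2)])
  finally show ?case .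
next
  case Nil
  then show ?case
    using left_mult_one_mat[OF l_mat_carrier[OF r]] right_mult_one_mat[OF l_mat_carrier[OF r]]
    by simp
qed

text \<open>
  This is the triangular case of the Cayley-Hamilton theorem, one factor at a time.
  The shift \<open>r - r\<^sub>m\<^sub>m\<close> of an upper triangular \<open>r\<close> maps the \<open>m\<close>-th basis vector into the span of the
  earlier ones, and preserves the span of the basis vectors before \<open>m\<close>.  So each new factor on the
  right kills one more column.
\<close>

lemma shift_prod_upt_columns:
  assumes r: "r \<in> borel_algebra n" and "m \<le> n" "\<iota> < n" "\<gamma> < m"
  shows "shift_prod n r [0..<m] $$ (\<iota>, \<gamma>) = 0"
  using assms(2-)
proof (induction m arbitrary: \<gamma>)
  case (Suc m)
  have rc: "r \<in> carrier_mat n n" and ut: "upper_triangular r"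
    using r by (auto simp: borel_algebra_def)
  let ?A = "shift_prod n r [0..<m]"
  have "shift_prod n r [0..<Suc m] = ?A * l_mat n r m"
    using rc right_mult_one_mat[OF l_mat_carrier[OF rc]] by (simp add: shift_prod_append)
  also have "\<dots> $$ (\<iota>, \<gamma>) = (\<Sum>k<n. ?A $$ (\<iota>, k) * l_mat n r m $$ (k, \<gamma>))"
    using Suc.prems shift_prod_carrier[OF rc, of "[0..<m]"] l_mat_carrier[OF rc, of m]
    by (auto simp: scalar_prod_def atLeast0LessThan intro!: sum.cong)
  also have "\<dots> = 0"
  proof (intro sum.neutral ballI)
    fix k assume k: "k \<in> {..<n}"
    show "?A $$ (\<iota>, k) * l_mat n r m $$ (k, \<gamma>) = 0"
    proof (cases "k < m")
      case True
      then show ?thesis using Suc.IH[of k] Suc.prems by simp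
    next
      case False
      then have "l_mat n r m $$ (k, \<gamma>) = 0"
        using k Suc.prems rc ut by (cases "k = m \<and> \<gamma> = m") (auto simp: l_mat_def)
      then show ?thesis by simp
    qed
  qed
  finally show ?case .
qed simp

lemma shift_prod_all_eq_0:
  assumes r: "r \<in> borel_algebra n"
  shows "shift_prod n r [0..<n] = 0\<^sub>m n n"
proof -
  have "shift_prod n r [0..<n] \<in> carrier_mat n n"
    using r by (simp add: borel_algebra_def)
  then show ?thesis
    using shift_prod_upt_columns[OF r order.refl] by (intro eq_matI) auto
qed

text \<open>
  Up to the order of its commuting factors, \<open>l_prod n r \<iota> * l_mat n r \<iota>\<close> is the product of all
  shifts, which vanishes.
\<close>

lemma l_prod_mult_self:
  assumes r: "r \<in> borel_algebra n" and \<iota>: "\<iota> < n"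
  shows "l_prod n r \<iota> * r = r $$ (\<iota>, \<iota>) \<cdot>\<^sub>m l_prod n r \<iota>"
proof -
  have rc: "r \<in> carrier_mat n n" using r by (simp add: borel_algebra_def)
  note carr = shift_prod_carrier[OF rc] l_mat_carrier[OF rc]
  have split: "[0..<n] = [0..<\<iota>] @ \<iota> # [Suc \<iota>..<n]"
    using \<iota> upt_add_eq_append[of 0 \<iota> "n - \<iota>"] by (simp add: upt_conv_Cons)
  have fil: "filter (\<lambda>k. k \<noteq> \<iota>) [0..<n] = [0..<\<iota>] @ [Suc \<iota>..<n]"
    unfolding split by (simp add: filter_id_conv)
  have "l_prod n r \<iota> * l_mat n r \<iota> = shift_prod n r [0..<n]"
    unfolding l_prod_eq_shift_prod fil split
    using carr by (simp add: shift_prod_append[OF rc] shift_prod_commute[OF rc]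
        assoc_mult_mat[of _ n n _ n _ n])
  also have "\<dots> = 0\<^sub>m n n" by (rule shift_prod_all_eq_0[OF r])
  finally have zero: "l_prod n r \<iota> * r - r $$ (\<iota>, \<iota>) \<cdot>\<^sub>m l_prod n r \<iota> = 0\<^sub>m n n"
    using rc by (simp add: mult_l_mat_right)
  have P: "l_prod n r \<iota> \<in> carrier_mat n n" using rc by simp
  show ?thesis
  proof (rule eq_matI)
    fix k l assume "k < dim_row (r $$ (\<iota>, \<iota>) \<cdot>\<^sub>m l_prod n r \<iota>)"
      "l < dim_col (r $$ (\<iota>, \<iota>) \<cdot>\<^sub>m l_prod n r \<iota>)"
    then show "(l_prod n r \<iota> * r) $$ (k, l) = (r $$ (\<iota>, \<iota>) \<cdot>\<^sub>m l_prod n r \<iota>) $$ (k, l)"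
      using arg_cong[OF zero, of "\<lambda>A. A $$ (k, l)"] carrier_matD[OF P] rc
      by (auto simp del: index_mult_mat(1))
  qed (use carrier_matD[OF P] rc in auto)
qed

section \<open>Diagonalizing the triangular matrix\<close>

text \<open>
  Multiplication from the left by \<open>matrix_unit n k * diag_part n b\<close> keeps row \<open>k\<close> alone, scaled by
  \<open>b\<^sub>k\<^sub>k\<close>, so only the summand \<open>k = \<iota>\<close> contributes to row \<open>\<iota>\<close> of \<open>b\<close>.
\<close>

lemma diagonalizer_entry:
  assumes r: "r \<in> carrier_mat n n"
    and b: "b = finsum (module_mat TYPE(complex) n n)
               (\<lambda>\<iota>. matrix_unit n \<iota> * diag_part n b * L_mat n r \<iota>) {0..<n}"
    and \<iota>: "\<iota> < n" and \<gamma>: "\<gamma> < n"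
  shows "b $$ (\<iota>, \<gamma>) =
    b $$ (\<iota>, \<iota>) * inverse (mat_trace (l_prod n r \<iota>)) * l_prod n r \<iota> $$ (\<iota>, \<gamma>)"
proof -
  have L: "L_mat n r k \<in> carrier_mat n n" for k using r by (simp add: L_mat_def)
  have E: "matrix_unit n k * diag_part n b * L_mat n r k =
      mat n n (\<lambda>(p, q). (if p = k then b $$ (p, p) else 0) * L_mat n r k $$ (p, q))" for k
    using L[of k]
    by (auto simp: matrix_unit_def diag_part_def mat_diag_mult_left intro!: eq_matI)
  have "b $$ (\<iota>, \<gamma>) = (\<Sum>k\<in>{0..<n}. (matrix_unit n k * diag_part n b * L_mat n r k) $$ (\<iota>, \<gamma>))"
    unfolding arg_cong[OF b, of "\<lambda>A. A $$ (\<iota>, \<gamma>)"]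
    by (rule index_finsum_mat) (use \<iota> \<gamma> E in auto)
  also have "\<dots> = (\<Sum>k\<in>{0..<n}. if \<iota> = k then b $$ (\<iota>, \<iota>) * L_mat n r k $$ (\<iota>, \<gamma>) else 0)"
    unfolding E using \<iota> \<gamma> by (intro sum.cong) auto
  also have "\<dots> = b $$ (\<iota>, \<iota>) * L_mat n r \<iota> $$ (\<iota>, \<gamma>)"
    using \<iota> by simp
  finally show ?thesis
    using \<iota> \<gamma> carrier_matD[OF l_prod_carrier[OF r, of \<iota>]] by (simp add: L_mat_def mult.assoc)
qed

lemma diagonalizer_mult:
  assumes r: "r \<in> borel_algebra n" and bc: "b \<in> carrier_mat n n"
    and b: "b = finsum (module_mat TYPE(complex) n n)
               (\<lambda>\<iota>. matrix_unit n \<iota> * diag_part n b * L_mat n r \<iota>) {0..<n}"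
  shows "b * r = diag_part n r * b"
proof (rule eq_matI)
  have rc: "r \<in> carrier_mat n n" using r by (simp add: borel_algebra_def)
  fix \<iota> \<gamma> assume "\<iota> < dim_row (diag_part n r * b)" "\<gamma> < dim_col (diag_part n r * b)"
  then have \<iota>: "\<iota> < n" and \<gamma>: "\<gamma> < n" using bc by (auto simp: diag_part_def mat_diag_def)
  let ?P = "l_prod n r \<iota>"
  let ?c = "b $$ (\<iota>, \<iota>) * inverse (mat_trace ?P)"
  have P: "?P \<in> carrier_mat n n" using rc by simp
  have row: "b $$ (\<iota>, l) = ?c * ?P $$ (\<iota>, l)" if "l < n" for l
    using diagonalizer_entry[OF rc b \<iota> that] .
  have "(b * r) $$ (\<iota>, \<gamma>) = (\<Sum>l\<in>{0..<n}. b $$ (\<iota>, l) * r $$ (l, \<gamma>))"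
    using \<iota> \<gamma> bc rc by (auto simp: scalar_prod_def)
  also have "\<dots> = (\<Sum>l\<in>{0..<n}. ?c * (?P $$ (\<iota>, l) * r $$ (l, \<gamma>)))"
    by (intro sum.cong[OF refl], subst row) auto
  also have "\<dots> = ?c * (?P * r) $$ (\<iota>, \<gamma>)"
    unfolding sum_distrib_left[symmetric]
    using \<iota> \<gamma> P rc carrier_matD[OF P] by (simp add: scalar_prod_def)
  also have "\<dots> = r $$ (\<iota>, \<iota>) * (?c * ?P $$ (\<iota>, \<gamma>))"
    unfolding l_prod_mult_self[OF r \<iota>] using \<iota> \<gamma> P by simp
  also have "\<dots> = (diag_part n r * b) $$ (\<iota>, \<gamma>)"
    unfolding row[OF \<gamma>, symmetric] using \<iota> \<gamma> bc by (simp add: diag_part_def mat_diag_mult_left)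
  finally show "(b * r) $$ (\<iota>, \<gamma>) = (diag_part n r * b) $$ (\<iota>, \<gamma>)" .
qed (use r bc in \<open>auto simp: borel_algebra_def diag_part_def mat_diag_def\<close>)

text \<open>
  Row \<open>\<iota>\<close> of \<open>b\<close> carries the inverse of this trace as a factor.  As \<open>inverse 0 = 0\<close>, the row would
  vanish together with the trace, and \<open>b\<close> would not be invertible.
\<close>

lemma diagonalizer_trace_nonzero:
  assumes rc: "r \<in> carrier_mat n n" and bB: "b \<in> borel_group n"
    and b: "b = finsum (module_mat TYPE(complex) n n)
               (\<lambda>\<iota>. matrix_unit n \<iota> * diag_part n b * L_mat n r \<iota>) {0..<n}"
    and \<iota>: "\<iota> < n"
  shows "mat_trace (l_prod n r \<iota>) \<noteq> 0"
proof
  assume "mat_trace (l_prod n r \<iota>) = 0"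
  then have "b $$ (\<iota>, l) = 0" if "l < n" for l
    using diagonalizer_entry[OF rc b \<iota> that] by simp
  moreover have "(b * minv b) $$ (\<iota>, \<iota>) = (\<Sum>l\<in>{0..<n}. b $$ (\<iota>, l) * minv b $$ (l, \<iota>))"
    using \<iota> bB minv(3)[OF bB] by (auto simp: borel_group_def borel_algebra_def scalar_prod_def)
  ultimately show False using \<iota> minv(1)[OF bB] by simp
qed

section \<open>Trace formula for the diagonal entries\<close>

lemma shift_prod_conj:
  assumes r: "r \<in> carrier_mat n n" and b: "b \<in> carrier_mat n n"
    and br: "b * r = diag_part n r * b"
  shows "b * shift_prod n r ks =
    mat_diag n (\<lambda>m. \<Prod>k\<leftarrow>ks. r $$ (m, m) - r $$ (k, k)) * b"
proof (induction ks)
  case Nil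
  then show ?case using b by simp
next
  case (Cons k ks)
  let ?D = "mat_diag n (\<lambda>m. r $$ (m, m) - r $$ (k, k))"
  let ?Q = "mat_diag n (\<lambda>m. \<Prod>k\<leftarrow>ks. r $$ (m, m) - r $$ (k, k))"
  have step: "b * l_mat n r k = ?D * b"
    unfolding mult_l_mat_right[OF b r] br
    using b by (intro eq_matI) (auto simp: diag_part_def mat_diag_mult_left algebra_simps)
  have "b * shift_prod n r (k # ks) = (b * l_mat n r k) * shift_prod n r ks"
    using b r by (simp add: assoc_mult_mat[of _ n n _ n _ n])
  also have "\<dots> = ?D * (b * shift_prod n r ks)"
    unfolding step using b r by (simp add: assoc_mult_mat[of _ n n _ n _ n])
  also have "\<dots> = (?D * ?Q) * b"
    unfolding Cons.IH using b by (simp add: assoc_mult_mat[of _ n n _ n _ n] del: mat_diag_diag)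
  finally show ?case by simp
qed

text \<open>
  Conjugated by \<open>b\<close>, the matrix \<open>l_prod n r \<iota>\<close> becomes diagonal with the product of the
  \<open>r\<^sub>m\<^sub>m - r\<^sub>k\<^sub>k\<close> over \<open>k \<noteq> \<iota>\<close> in place \<open>m\<close>; for \<open>m \<noteq> \<iota>\<close> the factor \<open>k = m\<close> is zero.  The
  scalar \<open>q\<close> is what remains in place \<open>\<iota>\<close>.  It does not depend on \<open>v\<close>, so it can be read off
  from \<open>v = 1\<close>.
\<close>

lemma trace_l_prod_mult:
  assumes r: "r \<in> carrier_mat n n" and b: "b \<in> borel_group n"
    and br: "b * r = diag_part n r * b" and \<iota>: "\<iota> < n"
  shows "\<exists>q. \<forall>v\<in>carrier_mat n n.
    mat_trace (l_prod n r \<iota> * v) = q * (b * v * minv b) $$ (\<iota>, \<iota>)"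
proof (intro exI ballI)
  define f where "f = (\<lambda>m. \<Prod>k\<leftarrow>filter (\<lambda>k. k \<noteq> \<iota>) [0..<n]. r $$ (m, m) - r $$ (k, k))"
  let ?P = "l_prod n r \<iota>"
  have bc: "b \<in> carrier_mat n n" and cc: "minv b \<in> carrier_mat n n"
    using b minv(3)[OF b] by (auto simp: borel_group_def borel_algebra_def)
  have P: "?P \<in> carrier_mat n n" using r by simp
  have bP: "b * ?P = mat_diag n f * b"
    unfolding l_prod_eq_shift_prod f_def by (rule shift_prod_conj[OF r bc br])
  have f0: "f m = 0" if "m < n" "m \<noteq> \<iota>" for m
    unfolding f_def prod_list_zero_iff using that by force
  fix v :: "complex mat" assume v: "v \<in> carrier_mat n n"
  let ?w = "b * v * minv b"
  have w: "?w \<in> carrier_mat n n" using bc v cc by auto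
  have "minv b * (b * ?P * v) = (minv b * b) * (?P * v)"
    unfolding assoc_mult_mat[OF bc P v]
    by (rule assoc_mult_mat[OF cc bc mult_carrier_mat[OF P v], symmetric])
  then have "?P * v = minv b * (b * ?P * v)"
    unfolding minv(2)[OF b] left_mult_one_mat[OF mult_carrier_mat[OF P v]] ..
  also have "mat_trace \<dots> = mat_trace (b * ?P * v * minv b)"
    using bc cc P v by (intro mat_trace_mult_commute[of _ n n]) auto
  also have "b * ?P * v * minv b = mat_diag n f * ?w"
    unfolding bP using bc cc v by (simp add: assoc_mult_mat[of _ n n _ n _ n] del: mat_diag_diag)
  also have "mat_trace \<dots> = (\<Sum>k<n. f k * ?w $$ (k, k))"
    by (rule mat_trace_diag_mult[OF w])
  also have "\<dots> = (\<Sum>k<n. if k = \<iota> then f \<iota> * ?w $$ (\<iota>, \<iota>) else 0)"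
    using f0 by (intro sum.cong) auto
  also have "\<dots> = f \<iota> * ?w $$ (\<iota>, \<iota>)" using \<iota> by simp
  finally show "mat_trace (?P * v) = f \<iota> * ?w $$ (\<iota>, \<iota>)" .
qed

lemma borel_algebra_mult:
  assumes A: "A \<in> borel_algebra n" and B: "B \<in> borel_algebra n"
  shows "A * B \<in> borel_algebra n"
proof -
  have "(A * B) $$ (\<iota>, \<gamma>) = 0" if "\<iota> < n" "\<gamma> < \<iota>" for \<iota> \<gamma>
  proof -
    have "(A * B) $$ (\<iota>, \<gamma>) = (\<Sum>k = 0..<n. A $$ (\<iota>, k) * B $$ (k, \<gamma>))"
      using A B that by (auto simp: borel_algebra_def scalar_prod_def)
    also have "\<dots> = 0"
    proof (intro sum.neutral ballI)
      fix k assume "k \<in> {0..<n}"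
      then show "A $$ (\<iota>, k) * B $$ (k, \<gamma>) = 0"
        using A B that by (cases "k < \<iota>") (auto simp: borel_algebra_def upper_triangular_def)
    qed
    finally show ?thesis .
  qed
  then show ?thesis using A B by (auto simp: borel_algebra_def)
qed

lemma l_prod_borel:
  assumes r: "r \<in> borel_algebra n"
  shows "l_prod n r \<iota> \<in> borel_algebra n"
proof -
  have "l_mat n r k \<in> borel_algebra n" for k
    using r by (auto simp: l_mat_def borel_algebra_def upper_triangular_def)
  moreover have "1\<^sub>m n \<in> borel_algebra n"
    by (simp add: borel_algebra_def)
  ultimately have "shift_prod n r ks \<in> borel_algebra n" for ks
    by (induction ks) (auto intro: borel_algebra_mult)
  then show ?thesis by (simp add: l_prod_eq_shift_prod)
qed

theorem proposition1p3:
  fixes n :: nat and r i j b r' i' j' :: "complex mat" and s s' :: "complex mat set"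
  assumes "n \<ge> 1"
    and "(r, s, i, j) \<in> moment_zero_rss n"
    and "b \<in> borel_group n"
    and "b = finsum (module_mat TYPE(complex) n n)
               (\<lambda>\<iota>. matrix_unit n \<iota> * diag_part n b * L_mat n r \<iota>) {0..<n}"
    and "borel_act n b (r, s, i, j) = (r', s', i', j')"
  shows "r' = diag_part n r \<and>
    (\<forall>\<iota><n. lower_rep n s' $$ (\<iota>, \<iota>) =
       inverse (mat_trace (l_prod n r \<iota>)) * trace_pairing (l_prod n r \<iota>) s)"
proof (intro conjI allI impI)
  have r: "r \<in> borel_algebra n" and "s \<in> borel_dual n"
    using assms(2) by (auto simp: moment_zero_rss_def cotangent_def)
  then obtain v where v: "v \<in> carrier_mat n n" and s: "s = coset_u n v"
    by (auto simp: borel_dual_def)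
  have rc: "r \<in> carrier_mat n n" using r by (simp add: borel_algebra_def)
  have bc: "b \<in> carrier_mat n n" and cc: "minv b \<in> carrier_mat n n"
    using assms(3) minv(3)[OF assms(3)] by (auto simp: borel_group_def borel_algebra_def)
  note br = diagonalizer_mult[OF r bc assms(4)]
  have r': "r' = b * r * minv b" and s': "s' = conj_dual n b s"
    using assms(5) by auto
  have dc: "diag_part n r \<in> carrier_mat n n" by (simp add: diag_part_def)
  show "r' = diag_part n r"
    unfolding r' br using minv(1)[OF assms(3)] bc cc dc
    by (simp add: assoc_mult_mat[of _ n n _ n _ n])
  fix \<iota> assume \<iota>: "\<iota> < n"
  let ?P = "l_prod n r \<iota>"
  obtain q where q: "\<And>v. v \<in> carrier_mat n n \<Longrightarrow>
      mat_trace (?P * v) = q * (b * v * minv b) $$ (\<iota>, \<iota>)"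
    using trace_l_prod_mult[OF rc assms(3) br \<iota>] by blast
  have "mat_trace ?P = q"
    using q[of "1\<^sub>m n"] minv(1)[OF assms(3)] rc bc \<iota> right_mult_one_mat[of ?P n n] by simp
  moreover have "lower_rep n s' $$ (\<iota>, \<iota>) = (b * v * minv b) $$ (\<iota>, \<iota>)"
    unfolding s' s conj_dual_coset[OF assms(3) v]
    using bc cc v \<iota> by (subst lower_rep_coset) auto
  moreover have "trace_pairing ?P s = mat_trace (?P * v)"
    unfolding s by (rule trace_pairing_coset[OF l_prod_borel[OF r] v])
  ultimately show "lower_rep n s' $$ (\<iota>, \<iota>) = inverse (mat_trace ?P) * trace_pairing ?P s"
    using diagonalizer_trace_nonzero[OF rc assms(3,4) \<iota>] q[OF v] by simp
qed

end
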